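(* Let $k$ be an even positive integer and let $v$ be an integer with $1\le v\le \left\lfloor \frac{k-1}{4} \right\rfloor$. Then $$S_{\mathfrak{z},2}^{(1,1)}(k;2;v) \leq \frac{k}{2}-2v,$$ where $S_{\mathfrak{z},2}^{(1,1)}(k;2;v)$ is the least positive integer $t$ such that for every coloring $\chi:[1,t]\to\{0,1\}$ there exist $x_1,\ldots,x_k\in[1,t]$ (not necessarily distinct) with $x_1+\cdots+x_{k-(2v+1)}=x_{k-2v}+\cdots+x_k$ and $\sum_{i=1}^k\chi(x_i)\equiv 0 \pmod 2$.
   Context: $[a,b]$ denotes the set of integers $n$ with $a\le n\le b$. A 2-coloring of $[1,t]$ is an arbitrary function $\chi:[1,t]\to\{0,1\}$, and colors are added as integers. The quantity is the special case $\ell=1$, $\epsilon=1$, $m=r=2$ of the zero-sum $\ell$-generalized Schur number $S_{\mathfrak{z},m}^{(\ell,\epsilon)}(k;r;v)$, which is the least positive integer $t$ such that every coloring $\chi:[1,t]\to\{0,\ldots,m-1\}$ admits a solution in $[1,t]$ of $x_1+\cdots+x_{k-(rv+\epsilon)} = x_{k-(rv+\epsilon-1)}+\cdots+x_{k-1}+\ell x_k$ with $\sum_{i=1}^k\chi(x_i)\equiv 0\pmod r$. *)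

theory Defs
  imports "HOL-Number_Theory.Cong" "HOL-Library.Extended_Nat" "HOL-Library.FuncSet"
begin

text \<open>
  Only the values of \<open>x\<close> on \<open>{1..k}\<close> matter.
  All instances of interest satisfy \<open>1 \<le> r * v + \<epsilon> < k\<close>, so the subtraction is exact;
  the right-hand side then has the unknowns with indices from \<open>k - (r * v + \<epsilon> - 1)\<close>
  to \<open>k\<close>, the last one having coefficient \<open>l\<close>.
\<close>
definition schur_solution ::
  "nat \<Rightarrow> nat \<Rightarrow> nat \<Rightarrow> nat \<Rightarrow> nat \<Rightarrow> nat \<Rightarrow> (nat \<Rightarrow> nat) \<Rightarrow> bool" where
  "schur_solution l \<epsilon> k r v t x \<longleftrightarrow>
     x \<in> {1..k} \<rightarrow> {1..t} \<and>
     (\<Sum>i\<in>{1..k - (r * v + \<epsilon>)}. x i) =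
       (\<Sum>i\<in>{k - (r * v + \<epsilon>)<..<k}. x i) + l * x k"

definition zero_sum_schur_property ::
  "nat \<Rightarrow> nat \<Rightarrow> nat \<Rightarrow> nat \<Rightarrow> nat \<Rightarrow> nat \<Rightarrow> nat \<Rightarrow> bool" where
  "zero_sum_schur_property l \<epsilon> m k r v t \<longleftrightarrow>
     (\<forall>\<chi> \<in> {1..t} \<rightarrow> {0..<m}.
        \<exists>x. schur_solution l \<epsilon> k r v t x \<and> [(\<Sum>i\<in>{1..k}. \<chi> (x i)) = 0] (mod r))"

text \<open>
  The least such \<open>t > 0\<close>, taken in \<^typ>\<open>enat\<close> so that the value is \<open>\<infinity>\<close> if there is none:
  a finite upper bound thus includes the assertion that the number exists.
\<close>
definition zero_sum_schur_number ::
  "nat \<Rightarrow> nat \<Rightarrow> nat \<Rightarrow> nat \<Rightarrow> nat \<Rightarrow> nat \<Rightarrow> enat" where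
  "zero_sum_schur_number l \<epsilon> m k r v =
     (INF t\<in>{t. t > 0 \<and> zero_sum_schur_property l \<epsilon> m k r v t}. enat t)"

lemma zero_sum_schur_number_eq_Least:
  assumes "\<exists>t>0. zero_sum_schur_property l \<epsilon> m k r v t"
  shows "zero_sum_schur_number l \<epsilon> m k r v =
           enat (LEAST t. t > 0 \<and> zero_sum_schur_property l \<epsilon> m k r v t)"
proof -
  let ?P = "\<lambda>t. t > 0 \<and> zero_sum_schur_property l \<epsilon> m k r v t"
  have "?P (LEAST t. ?P t)"
    using assms by (metis (mono_tags, lifting) LeastI_ex)
  moreover have "(LEAST t. ?P t) \<le> t" if "?P t" for t
    using that by (rule Least_le)
  ultimately show ?thesis
    unfolding zero_sum_schur_number_def
    by (intro antisym INF_lower INF_greatest) auto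
qed

end

theory Submission
  imports Defs
begin

text \<open>
  Take \<open>t = k / 2 - 2 v\<close> for two of the unknowns on the right-hand side and \<open>1\<close> for all others:
  both sides equal \<open>k - 2 v - 1\<close>, and since \<open>k\<close> is even each colour is counted an even
  number of times.
\<close>

lemma schur_solution_two_large:
  fixes k v :: nat
  assumes "even k" "1 \<le> v" "4 * v < k"
  defines "t \<equiv> k div 2 - 2 * v"
  shows "schur_solution 1 1 k 2 v t (\<lambda>i. if i \<in> {k - 1, k} then t else 1)"
proof -
  let ?x = "\<lambda>i. if i \<in> {k - 1, k} then t else 1"
  obtain j where j: "k = 2 * j" using assms by (elim evenE)
  have t: "1 \<le> t" "2 * t + 4 * v = k" using assms j by auto
  \<comment> \<open>As \<open>1 \<le> v\<close>, these indices stay below \<open>k - 1\<close>, so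
    both copies of \<open>t\<close> are on the right-hand side.\<close>
  have "(\<Sum>i\<in>{1..k - (2 * v + 1)}. ?x i) = (\<Sum>i\<in>{1..k - (2 * v + 1)}. 1)"
    using assms by (intro sum.cong) auto
  then have left: "(\<Sum>i\<in>{1..k - (2 * v + 1)}. ?x i) = k - (2 * v + 1)"
    by simp
  \<comment> \<open>Only one \<open>t\<close> lies in this sum: the unknown at index
    \<open>k\<close> is the separate last term. The other \<open>2 * v - 1\<close> unknowns are
    1.\<close>
  have "{k - (2 * v + 1)<..<k} = insert (k - 1) {k - (2 * v + 1)<..<k - 1}"
    using assms by auto
  then have "(\<Sum>i\<in>{k - (2 * v + 1)<..<k}. ?x i)
      = t + (\<Sum>i\<in>{k - (2 * v + 1)<..<k - 1}. ?x i)"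
    by simp
  also have "(\<Sum>i\<in>{k - (2 * v + 1)<..<k - 1}. ?x i) = (\<Sum>i\<in>{k - (2 * v + 1)<..<k - 1}. 1)"
    by (intro sum.cong) auto
  also have "\<dots> = 2 * v - 1"
    using assms by simp
  \<comment> \<open>By \<open>2 * t = k - 4 * v\<close>, the right-hand side is
    \<open>2 * t + (2 * v - 1) = k - 2 * v - 1\<close>.\<close>
  finally show ?thesis
    unfolding schur_solution_def using left t assms(2) by auto
qed

text \<open>One solution, chosen before the coloring, serves every \<chi>; hence \<open>m\<close> is
  arbitrary.\<close>

lemma zero_sum_schur_property_half:
  fixes k v :: nat
  assumes "even k" "1 \<le> v" "4 * v < k"
  shows "zero_sum_schur_property 1 1 m k 2 v (k div 2 - 2 * v)"
  unfolding zero_sum_schur_property_def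
proof (intro ballI exI conjI)
  fix \<chi> :: "nat \<Rightarrow> nat"
  let ?t = "k div 2 - 2 * v"
  let ?x = "\<lambda>i. if i \<in> {k - 1, k} then ?t else 1"
  show "schur_solution 1 1 k 2 v ?t ?x"
    using assms by (rule schur_solution_two_large)
  \<comment> \<open>Splitting by index, not by value, keeps the count valid when
    \<open>?t = 1\<close>.\<close>
  have split: "{1..k} = insert k (insert (k - 1) {1..k - 2})"
    using assms by auto
  have "(\<Sum>i\<in>{1..k - 2}. \<chi> (?x i)) = (\<Sum>i\<in>{1..k - 2}. \<chi> 1)"
    using assms by (intro sum.cong) auto
  then have "(\<Sum>i\<in>{1..k}. \<chi> (?x i)) = 2 * \<chi> ?t + (k - 2) * \<chi> 1"
    unfolding split using assms by (subst sum.insert; (subst sum.insert)?) auto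
  with \<open>even k\<close> show "[(\<Sum>i\<in>{1..k}. \<chi> (?x i)) = 0] (mod 2)"
    by (simp add: cong_0_iff)
qed

theorem theorem7:
  fixes k v :: nat
  assumes "even k" and "k > 0"
    and "1 \<le> v" and "v \<le> (k - 1) div 4"
  shows "zero_sum_schur_number 1 1 2 k 2 v \<le> enat (k div 2 - 2 * v)"
proof -
  have less: "4 * v < k" using assms by linarith
  \<comment> \<open>The infimum ranges over positive \<open>t\<close> only. Being even,
    \<open>k\<close> exceeds \<open>4 * v\<close> by at least 2.\<close>
  moreover have "0 < k div 2 - 2 * v" using \<open>even k\<close> less by (elim evenE) simp
  ultimately show ?thesis
    unfolding zero_sum_schur_number_def
    using zero_sum_schur_property_half assms by (intro INF_lower) blast
qed

end
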